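(* Let $f:\mathbb{R}\to\mathbb{R}$ and $\beta>0$ be such that $f(\beta)\le 0\le f(-\beta)$ and $f$ is continuously differentiable and nonconstant on $[-\beta,\beta]$, and set $\omega_0:=-1/\min_{|x|\le\beta}f'(x)$ (the minimum is negative, so $\omega_0>0$). Suppose that $\|u_0\|_{L^\infty}\le\beta$. Let $\{\boldsymbol U_m\}_{m=0}^{M}\subset\mathbb{R}^N$ be the numerical solution with $\boldsymbol U_0=(u_0(x_1),\dots,u_0(x_N))^T$ generated, for $m=0,1,\dots,M-1$, either by the LRI1a scheme $$\boldsymbol U_{m+1}=e^{\Delta t\,\boldsymbol A}\bigl(\boldsymbol U_m+\Delta t\,\boldsymbol f(\boldsymbol U_m)\bigr),$$ or by the LRI1b scheme $$\boldsymbol U_{m+1}=e^{\Delta t\,\boldsymbol A}\boldsymbol U_m+\Delta t\,\boldsymbol f\bigl(e^{\Delta t\,\boldsymbol A}\boldsymbol U_m\bigr).$$ If $0<\Delta t\le\omega_0$, then $$\|\boldsymbol U_m\|_\infty\le\beta,\qquad m=0,1,\dots,M.$$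
   Context: Setting (space discretization by central finite differences, homogeneous Neumann boundary conditions, of $\partial_t u=\varepsilon^2\Delta u+f(u)$ on $\Omega$ with initial datum $u_0:\overline\Omega\to\mathbb{R}$): $d\in\{1,2,3\}$, $\Omega\subset\mathbb{R}^d$ is an open bounded interval ($d=1$), rectangle ($d=2$) or rectangular parallelepiped ($d=3$), $\varepsilon>0$. A uniform grid with mesh size $h>0$ in every direction is used, with $n_k\ge2$ grid points (boundary points included) in direction $k$, $N=n_1\cdots n_d$, and grid points $x_1,\dots,x_N\in\overline\Omega$ (first coordinate varying fastest). For $n\ge 2$ let $\boldsymbol\lambda_h^{(n)}$ be $\frac1{h^2}$ times the $n\times n$ tridiagonal matrix with all diagonal entries $-2$, first row $(-2,2,0,\dots,0)$, last row $(0,\dots,0,2,-2)$, and every interior row having entries $1,-2,1$ in the sub-, main and superdiagonal positions. Set $\boldsymbol D_h=\boldsymbol\lambda_h^{(n_1)}$ if $d=1$; $\boldsymbol D_h=\boldsymbol I\otimes\boldsymbol\lambda_h^{(n_1)}+\boldsymbol\lambda_h^{(n_2)}\otimes\boldsymbol I$ if $d=2$; $\boldsymbol D_h=\boldsymbol I\otimes\boldsymbol I\otimes\boldsymbol\lambda_h^{(n_1)}+\boldsymbol I\otimes\boldsymbol\lambda_h^{(n_2)}\otimes\boldsymbol I+\boldsymbol\lambda_h^{(n_3)}\otimes\boldsymbol I\otimes\boldsymbol I$ if $d=3$ ($\otimes$ is the Kronecker product, $\boldsymbol I$ identity matrices of the appropriate sizes), and $\boldsymbol A=\varepsilon^2\boldsymbol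 D_h\in\mathbb{R}^{N\times N}$. Time grid: $T>0$ is fixed, $M$ is a positive integer, $\Delta t=T/M$, $t_m=m\Delta t$. Notation: $\boldsymbol f(\boldsymbol v)=(f(v_1),\dots,f(v_N))^T$ for $\boldsymbol v\in\mathbb{R}^N$; $\|\cdot\|_\infty$ is the maximum norm on $\mathbb{R}^N$; $\|u_0\|_{L^\infty}=\max_{x\in\overline\Omega}|u_0(x)|$. *)

theory Defs
  imports
    Complex_Main
    "HOL-Library.Extended_Real"
    "Jordan_Normal_Form.Matrix"
begin

text \<open>All matrix and vector indices, as well as the coordinate directions, start at 0.\<close>

definition max_norm :: "real vec \<Rightarrow> real" where
  "max_norm v = Max ((\<lambda>i. \<bar>v $ i\<bar>) ` {..<dim_vec v})"

text \<open>The norm \<open>max |u x|\<close> over \<open>x \<in> S\<close>, taken as a supremum in the extended reals: it is \<open>\<infinity>\<close> for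
  unbounded \<open>u\<close>, and it equals the maximum whenever the latter exists.\<close>

definition linf_norm_on :: "'a set \<Rightarrow> ('a \<Rightarrow> real) \<Rightarrow> ereal" where
  "linf_norm_on S u = (SUP x\<in>S. ereal \<bar>u x\<bar>)"

definition mat_exp :: "real mat \<Rightarrow> real mat" where
  "mat_exp A = mat (dim_row A) (dim_col A) (\<lambda>(i, j). \<Sum>k. (A ^\<^sub>m k) $$ (i, j) / fact k)"

lemma sum_abs_pow_mat_le:
  fixes A :: "real mat"
  assumes A: "A \<in> carrier_mat n n"
    and C: "\<And>i. i < n \<Longrightarrow> (\<Sum>j<n. \<bar>A $$ (i, j)\<bar>) \<le> C" and C1: "1 \<le> C"
    and i: "i < n"
  shows "(\<Sum>j<n. \<bar>(A ^\<^sub>m k) $$ (i, j)\<bar>) \<le> C ^ k"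
  using i
proof (induction k arbitrary: i)
  case 0
  have "(\<Sum>j<n. \<bar>(1\<^sub>m n) $$ (i, j)\<bar>) = (\<Sum>j<n. if j = i then 1 else (0::real))"
    using 0 by (intro sum.cong) auto
  then show ?case using 0 A by simp
next
  case (Suc k)
  let ?P = "A ^\<^sub>m k"
  have P: "?P \<in> carrier_mat n n" using A by simp
  have "(\<Sum>j<n. \<bar>(A ^\<^sub>m Suc k) $$ (i, j)\<bar>) = (\<Sum>j<n. \<bar>\<Sum>l<n. ?P $$ (i, l) * A $$ (l, j)\<bar>)"
    using A P Suc.prems
    by (intro sum.cong) (auto simp: scalar_prod_def lessThan_atLeast0)
  also have "\<dots> \<le> (\<Sum>j<n. \<Sum>l<n. \<bar>?P $$ (i, l)\<bar> * \<bar>A $$ (l, j)\<bar>)"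
    by (intro sum_mono order.trans[OF sum_abs]) (simp add: abs_mult)
  also have "\<dots> = (\<Sum>l<n. \<bar>?P $$ (i, l)\<bar> * (\<Sum>j<n. \<bar>A $$ (l, j)\<bar>))"
    by (subst sum.swap) (simp add: sum_distrib_left)
  also have "\<dots> \<le> (\<Sum>l<n. \<bar>?P $$ (i, l)\<bar> * C)"
    by (intro sum_mono mult_left_mono C) auto
  also have "\<dots> = (\<Sum>l<n. \<bar>?P $$ (i, l)\<bar>) * C"
    by (simp add: sum_distrib_right)
  also have "\<dots> \<le> C ^ k * C"
    using Suc C1 by (intro mult_right_mono) auto
  finally show ?case by (simp add: mult.commute)
qed

lemma mat_exp_sums:
  fixes A :: "real mat"
  assumes A: "A \<in> carrier_mat n n" and i: "i < n" and j: "j < n"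
  shows "(\<lambda>k. (A ^\<^sub>m k) $$ (i, j) / fact k) sums (mat_exp A $$ (i, j))"
proof -
  define C where "C = 1 + (\<Sum>i<n. \<Sum>j<n. \<bar>A $$ (i, j)\<bar>)"
  have C: "(\<Sum>j<n. \<bar>A $$ (i, j)\<bar>) \<le> C" if "i < n" for i
  proof -
    have "(\<Sum>j<n. \<bar>A $$ (i, j)\<bar>) \<le> (\<Sum>i<n. \<Sum>j<n. \<bar>A $$ (i, j)\<bar>)"
      using that by (intro member_le_sum) (auto intro: sum_nonneg)
    then show ?thesis by (simp add: C_def)
  qed
  have C1: "1 \<le> C" by (simp add: C_def sum_nonneg)
  have le: "norm ((A ^\<^sub>m k) $$ (i, j) / fact k) \<le> inverse (fact k) * C ^ k" for k
  proof -
    have "\<bar>(A ^\<^sub>m k) $$ (i, j)\<bar> \<le> (\<Sum>j<n. \<bar>(A ^\<^sub>m k) $$ (i, j)\<bar>)"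
      using j by (intro member_le_sum) auto
    also have "\<dots> \<le> C ^ k" by (rule sum_abs_pow_mat_le[OF A C C1 i])
    finally show ?thesis by (simp add: field_simps)
  qed
  have "summable (\<lambda>k. (A ^\<^sub>m k) $$ (i, j) / fact k)"
    by (rule summable_comparison_test'[OF summable_exp[of C], of 0]) (rule le)
  moreover have "mat_exp A $$ (i, j) = (\<Sum>k. (A ^\<^sub>m k) $$ (i, j) / fact k)"
    using A i j by (simp add: mat_exp_def)
  ultimately show ?thesis by (simp add: summable_sums)
qed

definition kron :: "'a::times mat \<Rightarrow> 'a mat \<Rightarrow> 'a mat" (infixl \<open>\<otimes>\<^sub>K\<close> 70) where
  "A \<otimes>\<^sub>K B = mat (dim_row A * dim_row B) (dim_col A * dim_col B)
     (\<lambda>(i, j). A $$ (i div dim_row B, j div dim_col B) * B $$ (i mod dim_row B, j mod dim_col B))"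

text \<open>The tridiagonal matrix \<open>\<lambda>\<^sub>h\<close> of size \<open>n\<close>, meant for \<open>n \<ge> 2\<close>.\<close>

definition neumann1d :: "real \<Rightarrow> nat \<Rightarrow> real mat" where
  "neumann1d h n = (1 / h\<^sup>2) \<cdot>\<^sub>m mat n n (\<lambda>(i, j).
     if i = j then - 2
     else if i = 0 \<and> j = 1 \<or> i = n - 1 \<and> j = n - 2 then 2
     else if j = i + 1 \<or> i = j + 1 then 1
     else 0)"

definition grid_size :: "nat \<Rightarrow> (nat \<Rightarrow> nat) \<Rightarrow> nat" where
  "grid_size d n = (\<Prod>k<d. n k)"

text \<open>Only meant for \<open>d \<in> {1, 2, 3}\<close>; \<open>n k\<close> is the number of grid points in direction \<open>k\<close>.\<close>

definition neumann_laplacian :: "nat \<Rightarrow> (nat \<Rightarrow> nat) \<Rightarrow> real \<Rightarrow> real mat" where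
  "neumann_laplacian d n h =
    (if d = 1 then neumann1d h (n 0)
     else if d = 2 then
       1\<^sub>m (n 1) \<otimes>\<^sub>K neumann1d h (n 0)
       + neumann1d h (n 1) \<otimes>\<^sub>K 1\<^sub>m (n 0)
     else
       1\<^sub>m (n 2) \<otimes>\<^sub>K 1\<^sub>m (n 1) \<otimes>\<^sub>K neumann1d h (n 0)
       + 1\<^sub>m (n 2) \<otimes>\<^sub>K neumann1d h (n 1) \<otimes>\<^sub>K 1\<^sub>m (n 0)
       + neumann1d h (n 2) \<otimes>\<^sub>K 1\<^sub>m (n 1) \<otimes>\<^sub>K 1\<^sub>m (n 0))"

text \<open>The closure of the open box with opposite corners \<open>a\<close> and \<open>b\<close>.\<close>

definition closed_box :: "nat \<Rightarrow> real vec \<Rightarrow> real vec \<Rightarrow> real vec set" where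
  "closed_box d a b = {x \<in> carrier_vec d. \<forall>k<d. a $ k \<le> x $ k \<and> x $ k \<le> b $ k}"

text \<open>The grid point with number \<open>j < grid_size d n\<close>, with the first coordinate varying fastest:
  \<open>j = i\<^sub>0 + n\<^sub>0 i\<^sub>1 + n\<^sub>0 n\<^sub>1 i\<^sub>2\<close> is the number of the point \<open>a + h (i\<^sub>0, i\<^sub>1, i\<^sub>2)\<close>.\<close>

definition grid_point :: "nat \<Rightarrow> (nat \<Rightarrow> nat) \<Rightarrow> real vec \<Rightarrow> real \<Rightarrow> nat \<Rightarrow> real vec" where
  "grid_point d n a h j = vec d (\<lambda>k. a $ k + real ((j div (\<Prod>l<k. n l)) mod n k) * h)"

definition lri1a_step :: "real mat \<Rightarrow> (real \<Rightarrow> real) \<Rightarrow> real \<Rightarrow> real vec \<Rightarrow> real vec" where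
  "lri1a_step A f \<tau> u = mat_exp (\<tau> \<cdot>\<^sub>m A) *\<^sub>v (u + \<tau> \<cdot>\<^sub>v map_vec f u)"

definition lri1b_step :: "real mat \<Rightarrow> (real \<Rightarrow> real) \<Rightarrow> real \<Rightarrow> real vec \<Rightarrow> real vec" where
  "lri1b_step A f \<tau> u =
     mat_exp (\<tau> \<cdot>\<^sub>m A) *\<^sub>v u + \<tau> \<cdot>\<^sub>v map_vec f (mat_exp (\<tau> \<cdot>\<^sub>m A) *\<^sub>v u)"

end

theory Submission
  imports Defs
begin

text \<open>The matrix \<open>A\<close> has nonnegative off-diagonal entries and vanishing row sums. Shifting by a large
  multiple of the identity makes it entrywise nonnegative, so \<open>exp (\<tau>A)\<close> is entrywise nonnegative;
  since \<open>A\<close> annihilates constants, its row sums are \<open>1\<close>, and it preserves \<open>{v. \<parallel>v\<parallel>\<^sub>\<infinity> \<le> \<beta>}\<close>.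
  For \<open>\<tau> \<le> \<omega>\<^sub>0\<close> the function \<open>x + \<tau> f x\<close> is nondecreasing on \<open>[-\<beta>, \<beta>]\<close>, and the signs of \<open>f\<close> at the
  endpoints show that it maps \<open>[-\<beta>, \<beta>]\<close> into itself. Both schemes compose these two maps.\<close>

section \<open>Exponentials of rate matrices\<close>

text \<open>The generators of continuous-time Markov chains on \<open>N\<close> states. The class is
  closed under sums, nonnegative multiples and Kronecker products with identities, which is how the
  discrete Laplacian enters it.\<close>

definition rate_matrix :: "nat \<Rightarrow> real mat \<Rightarrow> bool" where
  "rate_matrix N A \<longleftrightarrow> A \<in> carrier_mat N N \<and>
     (\<forall>i<N. \<forall>j<N. i \<noteq> j \<longrightarrow> 0 \<le> A $$ (i, j)) \<and> (\<forall>i<N. (\<Sum>j<N. A $$ (i, j)) = 0)"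

definition stochastic_matrix :: "nat \<Rightarrow> real mat \<Rightarrow> bool" where
  "stochastic_matrix N A \<longleftrightarrow> A \<in> carrier_mat N N \<and>
     (\<forall>i<N. \<forall>j<N. 0 \<le> A $$ (i, j)) \<and> (\<forall>i<N. (\<Sum>j<N. A $$ (i, j)) = 1)"

section \<open>Powers and exponentials under a shift by a multiple of the identity\<close>

lemma pow_mat_Suc_entry:
  assumes "A \<in> carrier_mat n n" "i < n" "j < n"
  shows "(A ^\<^sub>m Suc k) $$ (i, j) = (\<Sum>l<n. (A ^\<^sub>m k) $$ (i, l) * A $$ (l, j))"
proof -
  have "A ^\<^sub>m k \<in> carrier_mat n n" using assms by simp
  then show ?thesis using assms by (simp add: scalar_prod_def lessThan_atLeast0)
qed

text \<open>Pascal's rule in the form of the induction step of the binomial theorem: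
  \<open>g j\<close> stands for the \<open>j\<close>-th power of one summand, and
  \<open>g (Suc j) + s * g j\<close> for its product with the whole sum.\<close>

lemma sum_binomial_shift:
  fixes g :: "nat \<Rightarrow> 'a::comm_ring_1"
  shows "(\<Sum>j\<le>k. of_nat (k choose j) * s ^ (k - j) * (g (Suc j) + s * g j)) =
    (\<Sum>j\<le>Suc k. of_nat (Suc k choose j) * s ^ (Suc k - j) * g j)"
proof -
  have s: "s ^ (Suc k - j) = s * s ^ (k - j)" if "j \<le> k" for j
    using that by (simp add: Suc_diff_le)
  have "(\<Sum>j\<le>Suc k. of_nat (Suc k choose j) * s ^ (Suc k - j) * g j) =
      s ^ Suc k * g 0 + (\<Sum>j\<le>k. of_nat ((k choose j) + (k choose Suc j)) * s ^ (k - j) * g (Suc j))"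
    by (subst sum.atMost_Suc_shift) (simp only: binomial_Suc_Suc diff_Suc_Suc binomial_n_0 diff_zero of_nat_1 mult_1)
  also have "\<dots> = (\<Sum>j\<le>k. of_nat (k choose j) * s ^ (k - j) * g (Suc j)) +
      (s ^ Suc k * g 0 + (\<Sum>j\<le>k. of_nat (k choose Suc j) * s ^ (k - j) * g (Suc j)))"
    by (simp add: algebra_simps sum.distrib)
  also have "s ^ Suc k * g 0 + (\<Sum>j\<le>k. of_nat (k choose Suc j) * s ^ (k - j) * g (Suc j)) =
      (\<Sum>j\<le>Suc k. of_nat (k choose j) * s ^ (Suc k - j) * g j)"
    by (subst sum.atMost_Suc_shift) simp
  \<comment> \<open>The summand at \<open>j = Suc k\<close> vanishes because
    \<open>k choose Suc k = 0\<close>.\<close>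
  also have "\<dots> = (\<Sum>j\<le>k. of_nat (k choose j) * s ^ (k - j) * (s * g j))"
    by (simp add: s mult_ac binomial_eq_0)
  finally show ?thesis by (simp add: algebra_simps sum.distrib)
qed

text \<open>The binomial theorem for \<open>B\<close> and a multiple of the identity, which commute.
  The entrywise form keeps all sums scalar.\<close>

lemma pow_mat_add_smult_one:
  fixes B :: "'a::comm_ring_1 mat"
  assumes B: "B \<in> carrier_mat n n" and p: "p < n" and q: "q < n"
  shows "((B + s \<cdot>\<^sub>m 1\<^sub>m n) ^\<^sub>m k) $$ (p, q) =
    (\<Sum>j\<le>k. of_nat (k choose j) * s ^ (k - j) * (B ^\<^sub>m j) $$ (p, q))"
  using q
\<comment> \<open>Powers are expanded at their last factor, so the row \<open>p\<close> stays fixed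
  while the induction hypothesis is used at every intermediate column.\<close>
proof (induction k arbitrary: q)
  case 0
  then show ?case using B p by simp
next
  case (Suc k)
  let ?A = "B + s \<cdot>\<^sub>m 1\<^sub>m n"
  let ?c = "\<lambda>j. of_nat (k choose j) * s ^ (k - j)"
  have A: "?A \<in> carrier_mat n n" using B by simp
  have delta: "(\<Sum>l<n. (B ^\<^sub>m j) $$ (p, l) * (s * 1\<^sub>m n $$ (l, q))) = s * (B ^\<^sub>m j) $$ (p, q)" for j
  proof -
    have "(\<Sum>l<n. (B ^\<^sub>m j) $$ (p, l) * (s * 1\<^sub>m n $$ (l, q))) =
        (\<Sum>l<n. if l = q then s * (B ^\<^sub>m j) $$ (p, q) else 0)"
      using Suc.prems by (intro sum.cong) (auto simp: mult_ac)
    then show ?thesis using Suc.prems by simp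
  qed
  have "(?A ^\<^sub>m Suc k) $$ (p, q) = (\<Sum>l<n. (?A ^\<^sub>m k) $$ (p, l) * ?A $$ (l, q))"
    by (rule pow_mat_Suc_entry[OF A p Suc.prems])
  also have "\<dots> = (\<Sum>l<n. \<Sum>j\<le>k. ?c j * ((B ^\<^sub>m j) $$ (p, l) * ?A $$ (l, q)))"
    using Suc.IH by (intro sum.cong refl) (simp add: sum_distrib_right mult.assoc)
  also have "\<dots> = (\<Sum>j\<le>k. ?c j * (\<Sum>l<n. (B ^\<^sub>m j) $$ (p, l) * ?A $$ (l, q)))"
    by (subst sum.swap) (simp add: sum_distrib_left)
  also have "\<dots> = (\<Sum>j\<le>k. ?c j * (\<Sum>l<n. (B ^\<^sub>m j) $$ (p, l) * B $$ (l, q) +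
      (B ^\<^sub>m j) $$ (p, l) * (s * 1\<^sub>m n $$ (l, q))))"
    using B Suc.prems by (intro sum.cong arg_cong2[where f = "(*)"] refl) (auto simp: ring_distribs)
  also have "\<dots> = (\<Sum>j\<le>k. ?c j * ((B ^\<^sub>m Suc j) $$ (p, q) + s * (B ^\<^sub>m j) $$ (p, q)))"
    unfolding sum.distrib delta pow_mat_Suc_entry[OF B p Suc.prems] ..
  also have "\<dots> = (\<Sum>j\<le>Suc k. of_nat (Suc k choose j) * s ^ (Suc k - j) * (B ^\<^sub>m j) $$ (p, q))"
    by (rule sum_binomial_shift)
  finally show ?case .
qed

lemma pow_mat_nonneg:
  fixes B :: "real mat"
  assumes B: "B \<in> carrier_mat n n" and nn: "\<And>i j. i < n \<Longrightarrow> j < n \<Longrightarrow> 0 \<le> B $$ (i, j)"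
    and i: "i < n" and j: "j < n"
  shows "0 \<le> (B ^\<^sub>m k) $$ (i, j)"
  using j
proof (induction k arbitrary: j)
  case 0
  then show ?case using B i by simp
next
  case (Suc k)
  show ?case
    unfolding pow_mat_Suc_entry[OF B i Suc.prems]
    using Suc nn by (intro sum_nonneg mult_nonneg_nonneg) auto
qed

text \<open>The Cauchy product of the series of \<open>mat_exp B\<close> and of \<open>exp s\<close>
  has as its terms the binomial expansions of the powers of the shifted matrix.\<close>

lemma mat_exp_add_smult_one:
  fixes B :: "real mat"
  assumes B: "B \<in> carrier_mat n n" and i: "i < n" and j: "j < n"
  shows "mat_exp (B + s \<cdot>\<^sub>m 1\<^sub>m n) $$ (i, j) = mat_exp B $$ (i, j) * exp s"
proof -
  let ?x = "\<lambda>k. (B ^\<^sub>m k) $$ (i, j) / fact k" and ?y = "\<lambda>k. s ^ k / fact k"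
  \<comment> \<open>\<open>C\<close> bounds every absolute row sum of \<open>B\<close>, and the
    summand 1 ensures \<open>1 \<le> C\<close>, as \<open>sum_abs_pow_mat_le\<close> requires. The
    bound \<open>C ^ k / fact k\<close> then yields the absolute convergence on which the Cauchy
    product rests.\<close>
  define C where "C = 1 + (\<Sum>i<n. \<Sum>j<n. \<bar>B $$ (i, j)\<bar>)"
  have C: "(\<Sum>j<n. \<bar>B $$ (i, j)\<bar>) \<le> C" if "i < n" for i
  proof -
    have "(\<Sum>j<n. \<bar>B $$ (i, j)\<bar>) \<le> (\<Sum>i<n. \<Sum>j<n. \<bar>B $$ (i, j)\<bar>)"
      using that by (intro member_le_sum) (auto intro: sum_nonneg)
    then show ?thesis by (simp add: C_def)
  qed
  have C1: "1 \<le> C" by (simp add: C_def sum_nonneg)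
  have le: "norm (norm (?x k)) \<le> inverse (fact k) * C ^ k" for k
  proof -
    have "\<bar>(B ^\<^sub>m k) $$ (i, j)\<bar> \<le> (\<Sum>j<n. \<bar>(B ^\<^sub>m k) $$ (i, j)\<bar>)"
      using j by (intro member_le_sum) auto
    also have "\<dots> \<le> C ^ k" by (rule sum_abs_pow_mat_le[OF B C C1 i])
    finally show ?thesis by (simp add: field_simps)
  qed
  have x: "summable (\<lambda>k. norm (?x k))"
    by (rule summable_comparison_test'[OF summable_exp[of C], of 0]) (rule le)
  have y: "summable (\<lambda>k. norm (?y k))"
    using summable_norm_exp[of s] by (simp add: field_simps)
  have "(\<lambda>k. \<Sum>l\<le>k. ?x l * ?y (k - l)) sums ((\<Sum>k. ?x k) * (\<Sum>k. ?y k))"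
    by (rule Cauchy_product_sums[OF x y])
  \<comment> \<open>This is \<open>(k choose l) / fact k = 1 / (fact l * fact (k - l))\<close>,
    summand by summand.\<close>
  moreover have "(\<Sum>l\<le>k. ?x l * ?y (k - l)) = ((B + s \<cdot>\<^sub>m 1\<^sub>m n) ^\<^sub>m k) $$ (i, j) / fact k" for k
    unfolding pow_mat_add_smult_one[OF B i j] sum_divide_distrib
    by (intro sum.cong) (auto simp: binomial_fact field_simps)
  moreover have "(\<Sum>k. ?x k) = mat_exp B $$ (i, j)"
    using mat_exp_sums[OF B i j] by (simp add: sums_iff)
  moreover have "(\<Sum>k. ?y k) = exp s"
    by (simp add: exp_def field_simps)
  ultimately have "(\<lambda>k. ((B + s \<cdot>\<^sub>m 1\<^sub>m n) ^\<^sub>m k) $$ (i, j) / fact k) sums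
      (mat_exp B $$ (i, j) * exp s)"
    by simp
  moreover have "B + s \<cdot>\<^sub>m 1\<^sub>m n \<in> carrier_mat n n" using B by simp
  ultimately show ?thesis using mat_exp_sums[OF _ i j] sums_unique2 by blast
qed

lemma mat_exp_nonneg:
  assumes A: "rate_matrix n A" and i: "i < n" and j: "j < n"
  shows "0 \<le> mat_exp A $$ (i, j)"
proof -
  \<comment> \<open>\<open>c\<close> dominates the modulus of each diagonal entry, so adding
    \<open>c\<close> to the diagonal makes all entries nonnegative. Undoing the shift costs only the
    positive factor \<open>exp (- c)\<close>.\<close>
  define c where "c = (\<Sum>i<n. \<bar>A $$ (i, i)\<bar>)"
  define B where "B = A + c \<cdot>\<^sub>m 1\<^sub>m n"
  have cA: "A \<in> carrier_mat n n" using A by (simp add: rate_matrix_def)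
  then have B: "B \<in> carrier_mat n n" by (simp add: B_def)
  have Bnn: "0 \<le> B $$ (k, l)" if "k < n" "l < n" for k l
  proof (cases "k = l")
    case True
    have "\<bar>A $$ (k, k)\<bar> \<le> c"
      unfolding c_def using that by (intro member_le_sum) auto
    then show ?thesis using True that cA by (simp add: B_def)
  next
    case False
    then show ?thesis using that cA A by (simp add: B_def rate_matrix_def)
  qed
  have "A = B + (- c) \<cdot>\<^sub>m 1\<^sub>m n"
    using cA by (intro eq_matI) (auto simp: B_def)
  then have "mat_exp A $$ (i, j) = mat_exp B $$ (i, j) * exp (- c)"
    using mat_exp_add_smult_one[OF B i j] by metis
  moreover have "0 \<le> mat_exp B $$ (i, j)"
    using pow_mat_nonneg[OF B Bnn i j]
    by (intro sums_le[OF _ sums_zero mat_exp_sums[OF B i j]]) simp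
  ultimately show ?thesis by simp
qed

text \<open>Every positive power of a matrix with zero row sums again has zero row sums, so only the
  identity term of the series contributes to the row sums of the exponential.\<close>

lemma stochastic_mat_exp:
  assumes A: "rate_matrix n A"
  shows "stochastic_matrix n (mat_exp A)"
proof -
  have cA: "A \<in> carrier_mat n n" using A by (simp add: rate_matrix_def)
  have pow: "(\<Sum>j<n. (A ^\<^sub>m k) $$ (i, j)) = (if k = 0 then 1 else 0)" if i: "i < n" for i k
  proof (cases k)
    case 0
    have "(\<Sum>j<n. 1\<^sub>m n $$ (i, j)) = (\<Sum>j<n. if j = i then 1 else (0::real))"
      using i by (intro sum.cong) auto
    then show ?thesis using 0 cA i by simp
  next
    case (Suc l)
    have "(\<Sum>j<n. (A ^\<^sub>m k) $$ (i, j)) =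
        (\<Sum>j<n. \<Sum>m<n. (A ^\<^sub>m l) $$ (i, m) * A $$ (m, j))"
      unfolding Suc by (rule sum.cong[OF refl], rule pow_mat_Suc_entry[OF cA i]) simp
    also have "\<dots> = (\<Sum>m<n. (A ^\<^sub>m l) $$ (i, m) * (\<Sum>j<n. A $$ (m, j)))"
      by (subst sum.swap) (simp add: sum_distrib_left)
    also have "\<dots> = 0" using A by (simp add: rate_matrix_def)
    finally show ?thesis using Suc by simp
  qed
  have "(\<Sum>j<n. mat_exp A $$ (i, j)) = 1" if i: "i < n" for i
  proof -
    have "(\<lambda>k. \<Sum>j<n. (A ^\<^sub>m k) $$ (i, j) / fact k) sums (\<Sum>j<n. mat_exp A $$ (i, j))"
      using mat_exp_sums[OF cA i] by (intro sums_sum) auto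
    moreover have "(\<lambda>k. \<Sum>j<n. (A ^\<^sub>m k) $$ (i, j) / fact k) = (\<lambda>k. if k = 0 then 1 else 0)"
      unfolding sum_divide_distrib[symmetric] pow[OF i] by auto
    moreover have "(\<lambda>k::nat. if k = 0 then 1 else 0 :: real) sums 1"
      using sums_single[of 0 "\<lambda>_. 1::real"] by simp
    ultimately show ?thesis by (metis sums_unique2)
  qed
  moreover have "mat_exp A \<in> carrier_mat n n" using cA by (auto simp: mat_exp_def)
  ultimately show ?thesis
    using mat_exp_nonneg[OF A] by (simp add: stochastic_matrix_def)
qed

section \<open>The discrete Neumann Laplacian\<close>

lemma rate_matrix_add:
  assumes "rate_matrix N A" "rate_matrix N B"
  shows "rate_matrix N (A + B)"
  using assms by (auto simp: rate_matrix_def sum.distrib)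

lemma rate_matrix_smult:
  assumes "rate_matrix N A" "0 \<le> c"
  shows "rate_matrix N (c \<cdot>\<^sub>m A)"
  using assms by (auto simp: rate_matrix_def simp flip: sum_distrib_left)

lemma rate_matrix_neumann1d:
  assumes n: "n \<ge> 2"
  shows "rate_matrix n (neumann1d h n)"
proof -
  let ?A = "mat n n (\<lambda>(i, j). if i = j then - 2
     else if i = 0 \<and> j = 1 \<or> i = n - 1 \<and> j = n - 2 then 2
     else if j = i + 1 \<or> i = j + 1 then 1 else (0::real))"
  have "(\<Sum>j<n. ?A $$ (i, j)) = 0" if i: "i < n" for i
  proof -
    \<comment> \<open>First, last and interior rows. In each case the sum reduces to the columns
      where the row can be nonzero; for \<open>n = 2\<close> there are no interior rows.\<close>
    consider "i = 0" | "i = n - 1" "i \<noteq> 0" | "0 < i" "i < n - 1" using i by linarith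
    then show ?thesis
    proof cases
      case 1
      have "(\<Sum>j<n. ?A $$ (i, j)) = (\<Sum>j\<in>{0, 1}. ?A $$ (i, j))"
        using 1 n by (intro sum.mono_neutral_right) auto
      then show ?thesis using 1 n by simp
    next
      case 2
      have "(\<Sum>j<n. ?A $$ (i, j)) = (\<Sum>j\<in>{n - 1, n - 2}. ?A $$ (i, j))"
        using 2 n by (intro sum.mono_neutral_right) auto
      moreover have "n - 1 \<noteq> n - 2" using n by linarith
      ultimately show ?thesis using 2 by simp
    next
      case 3
      have "(\<Sum>j<n. ?A $$ (i, j)) = (\<Sum>j\<in>{i - 1, i, i + 1}. ?A $$ (i, j))"
        using 3 n by (intro sum.mono_neutral_right) auto
      \<comment> \<open>Writing \<open>i\<close> as a successor removes the truncated subtraction in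
        \<open>i - 1\<close>.\<close>
      moreover obtain l where "i = Suc l" using 3 gr0_implies_Suc by blast
      ultimately show ?thesis using 3 by simp
    qed
  qed
  then have "rate_matrix n ?A" by (auto simp: rate_matrix_def)
  \<comment> \<open>The factor \<open>1 / h\<^sup>2\<close> is nonnegative for every real
    \<open>h\<close>; at \<open>h = 0\<close> the division yields 0.\<close>
  then show ?thesis unfolding neumann1d_def by (rule rate_matrix_smult) simp
qed

section \<open>Kronecker products and their row sums\<close>

lemma sum_div_mod_mult:
  fixes f g :: "nat \<Rightarrow> 'a::semiring_0"
  shows "(\<Sum>j<m * n. f (j div n) * g (j mod n)) = (\<Sum>k<m. f k) * (\<Sum>l<n. g l)"
proof -
  have "(\<Sum>j<m * n. f (j div n) * g (j mod n)) =
      (\<Sum>k<m. \<Sum>j=k * n..<k * n + n. f (j div n) * g (j mod n))"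
    by (rule sum.nat_group[symmetric])
  also have "\<dots> = (\<Sum>k<m. \<Sum>l<n. f k * g l)"
  proof (rule sum.cong[OF refl])
    fix k
    have "(\<Sum>j=k * n..<k * n + n. f (j div n) * g (j mod n)) =
        (\<Sum>l=0..<n. f ((l + k * n) div n) * g ((l + k * n) mod n))"
      using sum.shift_bounds_nat_ivl[of "\<lambda>j. f (j div n) * g (j mod n)" 0 "k * n" n]
      by (simp add: add.commute)
    also have "\<dots> = (\<Sum>l<n. f k * g l)"
      unfolding lessThan_atLeast0 by (intro sum.cong) auto
    finally show "(\<Sum>j=k * n..<k * n + n. f (j div n) * g (j mod n)) = (\<Sum>l<n. f k * g l)" .
  qed
  also have "\<dots> = (\<Sum>k<m. f k) * (\<Sum>l<n. g l)"
    by (simp add: sum_product)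
  finally show ?thesis .
qed

lemma kron_carrier_mat:
  "A \<in> carrier_mat m p \<Longrightarrow> B \<in> carrier_mat n q \<Longrightarrow> A \<otimes>\<^sub>K B \<in> carrier_mat (m * n) (p * q)"
  by (auto simp: kron_def)

lemma kron_entry:
  assumes "A \<in> carrier_mat m p" "B \<in> carrier_mat n q" "i < m * n" "j < p * q"
  shows "(A \<otimes>\<^sub>K B) $$ (i, j) = A $$ (i div n, j div q) * B $$ (i mod n, j mod q)"
  using assms by (auto simp: kron_def)

lemma div_mod_less_mult:
  fixes i m n :: nat
  assumes "i < m * n"
  shows "i div n < m" "i mod n < n"
  using assms by (auto simp: less_mult_imp_div_less intro!: mod_less_divisor gr0I)

text \<open>A column index \<open>j\<close> corresponds to the pair
  \<open>(j div q, j mod q)\<close>, over which the double sum factorizes. A zero row sum of one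
  factor thus passes to the product.\<close>

lemma kron_row_sum:
  fixes A B :: "'a::semiring_0 mat"
  assumes A: "A \<in> carrier_mat m p" and B: "B \<in> carrier_mat n q" and i: "i < m * n"
  shows "(\<Sum>j<p * q. (A \<otimes>\<^sub>K B) $$ (i, j)) =
    (\<Sum>k<p. A $$ (i div n, k)) * (\<Sum>l<q. B $$ (i mod n, l))"
proof -
  have "(\<Sum>j<p * q. (A \<otimes>\<^sub>K B) $$ (i, j)) =
      (\<Sum>j<p * q. A $$ (i div n, j div q) * B $$ (i mod n, j mod q))"
    by (intro sum.cong refl kron_entry[OF A B i]) simp
  also have "\<dots> = (\<Sum>k<p. A $$ (i div n, k)) * (\<Sum>l<q. B $$ (i mod n, l))"
    by (rule sum_div_mod_mult)
  finally show ?thesis .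
qed

lemma eq_iff_div_mod_eq: "i = j \<longleftrightarrow> i div n = j div n \<and> i mod n = j mod (n::nat)"
  by (metis div_mult_mod_eq)

text \<open>Merges the two leading identities of the first three-dimensional term, so that a single
  Kronecker product with an identity remains.\<close>

lemma kron_one_one: "1\<^sub>m m \<otimes>\<^sub>K 1\<^sub>m n = (1\<^sub>m (m * n) :: real mat)"
proof (rule eq_matI)
  fix i j
  assume "i < dim_row (1\<^sub>m (m * n) :: real mat)" "j < dim_col (1\<^sub>m (m * n) :: real mat)"
  then have i: "i < m * n" and j: "j < m * n" by auto
  then show "(1\<^sub>m m \<otimes>\<^sub>K 1\<^sub>m n) $$ (i, j) = (1\<^sub>m (m * n) :: real mat) $$ (i, j)"
    using div_mod_less_mult[OF i] div_mod_less_mult[OF j] eq_iff_div_mod_eq[of i j n]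
    by (subst kron_entry[OF one_carrier_mat one_carrier_mat i j]) auto
qed (simp_all add: kron_def)

text \<open>For \<open>i \<noteq> j\<close>, either the block indices differ and the identity
  contributes 0, or they agree and the inner indices differ, so the entry is an off-diagonal entry
  of \<open>A\<close>.\<close>

lemma rate_matrix_kron_one_left:
  assumes A: "rate_matrix n A"
  shows "rate_matrix (m * n) (1\<^sub>m m \<otimes>\<^sub>K A)"
  unfolding rate_matrix_def
proof (intro conjI allI impI)
  have cA: "A \<in> carrier_mat n n" using A by (simp add: rate_matrix_def)
  show "1\<^sub>m m \<otimes>\<^sub>K A \<in> carrier_mat (m * n) (m * n)"
    by (rule kron_carrier_mat[OF one_carrier_mat cA])
  fix i
  assume i: "i < m * n"
  show "(\<Sum>j<m * n. (1\<^sub>m m \<otimes>\<^sub>K A) $$ (i, j)) = 0"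
    using A div_mod_less_mult[OF i]
    by (simp add: kron_row_sum[OF one_carrier_mat cA i] rate_matrix_def)
  fix j
  assume j: "j < m * n" and "i \<noteq> j"
  then show "0 \<le> (1\<^sub>m m \<otimes>\<^sub>K A) $$ (i, j)"
    using A div_mod_less_mult[OF i] div_mod_less_mult[OF j] eq_iff_div_mod_eq[of i j n]
    by (subst kron_entry[OF one_carrier_mat cA i j]) (auto simp: rate_matrix_def)
qed

lemma rate_matrix_kron_one_right:
  assumes A: "rate_matrix m A"
  shows "rate_matrix (m * n) (A \<otimes>\<^sub>K 1\<^sub>m n)"
  unfolding rate_matrix_def
proof (intro conjI allI impI)
  have cA: "A \<in> carrier_mat m m" using A by (simp add: rate_matrix_def)
  show "A \<otimes>\<^sub>K 1\<^sub>m n \<in> carrier_mat (m * n) (m * n)"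
    by (rule kron_carrier_mat[OF cA one_carrier_mat])
  fix i
  assume i: "i < m * n"
  show "(\<Sum>j<m * n. (A \<otimes>\<^sub>K 1\<^sub>m n) $$ (i, j)) = 0"
    using A div_mod_less_mult[OF i]
    by (simp add: kron_row_sum[OF cA one_carrier_mat i] rate_matrix_def)
  fix j
  assume j: "j < m * n" and "i \<noteq> j"
  then show "0 \<le> (A \<otimes>\<^sub>K 1\<^sub>m n) $$ (i, j)"
    using A div_mod_less_mult[OF i] div_mod_less_mult[OF j] eq_iff_div_mod_eq[of i j n]
    by (subst kron_entry[OF cA one_carrier_mat i j]) (auto simp: rate_matrix_def)
qed

lemma rate_matrix_neumann_laplacian:
  assumes d: "d \<in> {1, 2, 3}" and n: "\<And>k. k < d \<Longrightarrow> n k \<ge> 2"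
  shows "rate_matrix (grid_size d n) (neumann_laplacian d n h)"
proof -
  have L: "rate_matrix (n k) (neumann1d h (n k))" if "k < d" for k
    using rate_matrix_neumann1d n that by blast
  consider "d = 1" | "d = 2" | "d = 3" using d by auto
  then show ?thesis
  proof cases
    case 1
    then show ?thesis using L[of 0] by (simp add: neumann_laplacian_def grid_size_def)
  next
    case 2
    have N: "grid_size d n = n 1 * n 0"
      using 2 by (simp add: grid_size_def numeral_2_eq_2)
    have "rate_matrix (grid_size d n) (1\<^sub>m (n 1) \<otimes>\<^sub>K neumann1d h (n 0))"
      "rate_matrix (grid_size d n) (neumann1d h (n 1) \<otimes>\<^sub>K 1\<^sub>m (n 0))"
      unfolding N using 2 by (auto intro!: rate_matrix_kron_one_left rate_matrix_kron_one_right L)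
    then show ?thesis using 2 by (simp add: neumann_laplacian_def rate_matrix_add)
  next
    case 3
    \<comment> \<open>The factors are ordered and bracketed as in the left-associated Kronecker
      products, where the last factor belongs to the fastest coordinate.\<close>
    have N: "grid_size d n = n 2 * n 1 * n 0"
      using 3 by (simp add: grid_size_def numeral_2_eq_2 numeral_3_eq_3)
    have "rate_matrix (grid_size d n) (1\<^sub>m (n 2) \<otimes>\<^sub>K 1\<^sub>m (n 1) \<otimes>\<^sub>K neumann1d h (n 0))"
      "rate_matrix (grid_size d n) (1\<^sub>m (n 2) \<otimes>\<^sub>K neumann1d h (n 1) \<otimes>\<^sub>K 1\<^sub>m (n 0))"
      "rate_matrix (grid_size d n) (neumann1d h (n 2) \<otimes>\<^sub>K 1\<^sub>m (n 1) \<otimes>\<^sub>K 1\<^sub>m (n 0))"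
      unfolding N kron_one_one using 3
      by (auto intro!: rate_matrix_kron_one_left rate_matrix_kron_one_right L)
    then show ?thesis using 3 by (simp add: neumann_laplacian_def rate_matrix_add)
  qed
qed

section \<open>The maximum bound\<close>

text \<open>The closed ball of radius \<beta> in the maximum norm, stated entrywise with the
  dimension built in; this avoids \<open>Max\<close> of a possibly empty set.\<close>

definition vec_bounded :: "nat \<Rightarrow> real \<Rightarrow> real vec \<Rightarrow> bool" where
  "vec_bounded N \<beta> v \<longleftrightarrow> v \<in> carrier_vec N \<and> (\<forall>i<N. \<bar>v $ i\<bar> \<le> \<beta>)"

lemma max_norm_le:
  assumes "vec_bounded N \<beta> v" "0 < N"
  shows "max_norm v \<le> \<beta>"
proof -
  have "(\<lambda>i. \<bar>v $ i\<bar>) ` {..<dim_vec v} \<noteq> {}"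
    using assms by (auto simp: vec_bounded_def)
  then show ?thesis
    using assms unfolding max_norm_def by (subst Max_le_iff) (auto simp: vec_bounded_def)
qed

text \<open>Each entry of \<open>E *\<^sub>v v\<close> is a convex combination of entries of
  \<open>v\<close>.\<close>

lemma stochastic_mult_vec_bounded:
  assumes E: "stochastic_matrix N E" and v: "vec_bounded N \<beta> v"
  shows "vec_bounded N \<beta> (E *\<^sub>v v)"
proof -
  have cE: "E \<in> carrier_mat N N" and cv: "v \<in> carrier_vec N"
    using E v by (auto simp: stochastic_matrix_def vec_bounded_def)
  have "\<bar>(E *\<^sub>v v) $ i\<bar> \<le> \<beta>" if i: "i < N" for i
  proof -
    have "\<bar>(E *\<^sub>v v) $ i\<bar> = \<bar>\<Sum>j<N. E $$ (i, j) * v $ j\<bar>"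
      using cE cv i by (auto simp: scalar_prod_def lessThan_atLeast0)
    also have "\<dots> \<le> (\<Sum>j<N. E $$ (i, j) * \<beta>)"
      using E v i
      by (intro order.trans[OF sum_abs] sum_mono)
        (auto simp: abs_mult stochastic_matrix_def vec_bounded_def intro!: mult_left_mono)
    also have "\<dots> = \<beta>"
      using E i by (simp add: stochastic_matrix_def flip: sum_distrib_right)
    finally show ?thesis .
  qed
  moreover have "E *\<^sub>v v \<in> carrier_vec N" using cE cv by (rule mult_mat_vec_carrier)
  ultimately show ?thesis by (simp add: vec_bounded_def)
qed

lemma euler_step_vec_bounded:
  assumes "\<And>x. \<bar>x\<bar> \<le> \<beta> \<Longrightarrow> \<bar>x + \<tau> * f x\<bar> \<le> \<beta>" and "vec_bounded N \<beta> v"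
  shows "vec_bounded N \<beta> (v + \<tau> \<cdot>\<^sub>v map_vec f v)"
  using assms by (auto simp: vec_bounded_def)

text \<open>LRI1a applies the Euler map before the exponential, LRI1b after it; the ball is
  invariant under both maps, hence under either order.\<close>

lemma lri_step_vec_bounded:
  assumes A: "rate_matrix N A" and \<tau>: "0 \<le> \<tau>"
    and g: "\<And>x. \<bar>x\<bar> \<le> \<beta> \<Longrightarrow> \<bar>x + \<tau> * f x\<bar> \<le> \<beta>"
    and u: "vec_bounded N \<beta> u"
  shows "vec_bounded N \<beta> (lri1a_step A f \<tau> u)" "vec_bounded N \<beta> (lri1b_step A f \<tau> u)"
proof -
  have E: "stochastic_matrix N (mat_exp (\<tau> \<cdot>\<^sub>m A))"
    by (intro stochastic_mat_exp rate_matrix_smult A \<tau>)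
  show "vec_bounded N \<beta> (lri1a_step A f \<tau> u)"
    unfolding lri1a_step_def
    by (intro stochastic_mult_vec_bounded[OF E] euler_step_vec_bounded g u)
  show "vec_bounded N \<beta> (lri1b_step A f \<tau> u)"
    unfolding lri1b_step_def
    by (intro euler_step_vec_bounded g stochastic_mult_vec_bounded[OF E] u)
qed

section \<open>Monotonicity and the forward Euler map\<close>

text \<open>The derivatives at the endpoints are one-sided. They provide continuity there, and the
  mean value argument uses two-sided derivatives at interior points only.\<close>

lemma mono_on_if_deriv_nonneg_within:
  fixes g g' :: "real \<Rightarrow> real"
  assumes deriv: "\<And>x. x \<in> {a..b} \<Longrightarrow> (g has_real_derivative g' x) (at x within {a..b})"
    and nn: "\<And>x. x \<in> {a..b} \<Longrightarrow> 0 \<le> g' x"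
  shows "mono_on {a..b} g"
proof (rule mono_onI)
  fix x y assume xy: "x \<in> {a..b}" "y \<in> {a..b}" "x \<le> y"
  have cont: "continuous_on {a..b} g"
    using deriv by (meson DERIV_continuous continuous_on_eq_continuous_within)
  show "g x \<le> g y"
  proof (rule DERIV_nonneg_imp_increasing_open[OF \<open>x \<le> y\<close>])
    fix z assume z: "x < z" "z < y"
    then have "at z within {a..b} = at z"
      using xy by (intro at_within_Icc_at) auto
    then show "\<exists>D. (g has_real_derivative D) (at z) \<and> 0 \<le> D"
      using deriv[of z] nn[of z] xy z by (intro exI[of _ "g' z"]) auto
  next
    show "continuous_on {x..y} g"
      using cont by (rule continuous_on_subset) (use xy in auto)
  qed
qed

text \<open>Otherwise \<open>f\<close> is nondecreasing, and
  \<open>c \<le> f a \<le> f x \<le> f b \<le> c\<close> makes it constant. With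
  \<open>c = 0\<close> this gives the negativity of \<mu>.\<close>

lemma neg_deriv_if_nonconst:
  fixes f f' :: "real \<Rightarrow> real"
  assumes sign: "f b \<le> c" "c \<le> f a"
    and deriv: "\<And>x. x \<in> {a..b} \<Longrightarrow> (f has_real_derivative f' x) (at x within {a..b})"
    and nonconst: "\<not> (\<exists>c. \<forall>x\<in>{a..b}. f x = c)"
  shows "\<exists>x\<in>{a..b}. f' x < 0"
proof (rule ccontr)
  assume "\<not> (\<exists>x\<in>{a..b}. f' x < 0)"
  then have "mono_on {a..b} f"
    using deriv by (intro mono_on_if_deriv_nonneg_within[of a b f f']) (auto simp: not_less)
  then have "f a \<le> f x \<and> f x \<le> f b" if "x \<in> {a..b}" for x
    using that by (auto simp: mono_on_def)
  then have "\<forall>x\<in>{a..b}. f x = c"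
    using sign by fastforce
  then show False using nonconst by blast
qed

text \<open>Assumption \<open>lb\<close> is the step size restriction in division-free form: it says
  that \<open>x + \<tau> * f x\<close> has nonnegative derivative.\<close>

lemma euler_map_bounded:
  fixes f f' :: "real \<Rightarrow> real"
  assumes sign: "f \<beta> \<le> 0" "0 \<le> f (- \<beta>)"
    and deriv: "\<And>x. x \<in> {-\<beta>..\<beta>} \<Longrightarrow> (f has_real_derivative f' x) (at x within {-\<beta>..\<beta>})"
    and lb: "\<And>x. x \<in> {-\<beta>..\<beta>} \<Longrightarrow> - 1 \<le> \<tau> * f' x"
    and \<tau>: "0 \<le> \<tau>" and x: "\<bar>x\<bar> \<le> \<beta>"
  shows "\<bar>x + \<tau> * f x\<bar> \<le> \<beta>"
proof -
  have "mono_on {-\<beta>..\<beta>} (\<lambda>x. x + \<tau> * f x)"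
  proof (rule mono_on_if_deriv_nonneg_within)
    fix x assume x: "x \<in> {-\<beta>..\<beta>}"
    show "((\<lambda>x. x + \<tau> * f x) has_real_derivative 1 + \<tau> * f' x) (at x within {-\<beta>..\<beta>})"
      by (auto intro!: derivative_eq_intros deriv[OF x])
    show "0 \<le> 1 + \<tau> * f' x" using lb[OF x] by simp
  qed
  then have le: "y + \<tau> * f y \<le> z + \<tau> * f z" if "- \<beta> \<le> y" "y \<le> z" "z \<le> \<beta>" for y z
    by (rule mono_onD) (use that in auto)
  have "- \<beta> + \<tau> * f (- \<beta>) \<le> x + \<tau> * f x" "x + \<tau> * f x \<le> \<beta> + \<tau> * f \<beta>"
    using le[of "- \<beta>" x] le[of x \<beta>] x by auto
  moreover have "0 \<le> \<tau> * f (- \<beta>)" "\<tau> * f \<beta> \<le> 0"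
    using sign \<tau> by (auto intro: mult_nonneg_nonpos)
  ultimately show ?thesis by linarith
qed

text \<open>The index in direction \<open>k\<close> is a residue modulo the positive number
  \<open>n k\<close>, hence at most \<open>n k - 1\<close>, and that last index gives the corner
  coordinate \<open>b $ k\<close>.\<close>

lemma grid_point_in_closed_box:
  assumes h: "0 \<le> h" and n: "\<And>k. k < d \<Longrightarrow> 0 < n k"
    and ab: "\<And>k. k < d \<Longrightarrow> b $ k = a $ k + real (n k - 1) * h"
  shows "grid_point d n a h j \<in> closed_box d a b"
proof -
  have "real (i mod n k) * h \<le> real (n k - 1) * h" if "k < d" for i k
  proof -
    have "i mod n k \<le> n k - 1" using mod_less_divisor[OF n[OF that], of i] by linarith
    then show ?thesis using h by (intro mult_right_mono) auto
  qed
  then show ?thesis using h ab by (auto simp: grid_point_def closed_box_def)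
qed

theorem theorem2:
  fixes d M :: nat and n :: "nat \<Rightarrow> nat"
    and \<epsilon> h T \<Delta>t \<beta> \<mu> \<omega>\<^sub>0 :: real
    and a b :: "real vec"
    and u\<^sub>0 :: "real vec \<Rightarrow> real"
    and f f' :: "real \<Rightarrow> real"
    and A :: "real mat"
    and U :: "nat \<Rightarrow> real vec"
  assumes d: "d \<in> {1, 2, 3}"
    and eps: "\<epsilon> > 0"
    and h: "h > 0"
    and n: "\<And>k. k < d \<Longrightarrow> n k \<ge> 2"
    and a: "a \<in> carrier_vec d" and b: "b \<in> carrier_vec d"
    and ab: "\<And>k. k < d \<Longrightarrow> b $ k = a $ k + real (n k - 1) * h"
    and A: "A = \<epsilon>\<^sup>2 \<cdot>\<^sub>m neumann_laplacian d n h"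
    and T: "T > 0" and M: "M > 0" and dt: "\<Delta>t = T / real M"
    and beta: "\<beta> > 0"
    and f_sign: "f \<beta> \<le> 0" "0 \<le> f (- \<beta>)"
    and f_deriv: "\<And>x. x \<in> {-\<beta>..\<beta>} \<Longrightarrow> (f has_real_derivative f' x) (at x within {-\<beta>..\<beta>})"
    and f'_cont: "continuous_on {-\<beta>..\<beta>} f'"
    and f_nonconst: "\<not> (\<exists>c. \<forall>x\<in>{-\<beta>..\<beta>}. f x = c)"
    and mu: "\<mu> = (INF x\<in>{-\<beta>..\<beta>}. f' x)"
    and omega0: "\<omega>\<^sub>0 = - 1 / \<mu>"
    and u0: "linf_norm_on (closed_box d a b) u\<^sub>0 \<le> ereal \<beta>"
    and U0: "U 0 = vec (grid_size d n) (\<lambda>j. u\<^sub>0 (grid_point d n a h j))"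
    and scheme: "(\<forall>m<M. U (Suc m) = lri1a_step A f \<Delta>t (U m)) \<or>
                 (\<forall>m<M. U (Suc m) = lri1b_step A f \<Delta>t (U m))"
  shows "\<mu> < 0 \<and> \<omega>\<^sub>0 > 0 \<and>
    (0 < \<Delta>t \<and> \<Delta>t \<le> \<omega>\<^sub>0 \<longrightarrow> (\<forall>m\<le>M. max_norm (U m) \<le> \<beta>))"
proof -
  \<comment> \<open>The continuous \<open>f'\<close> attains its minimum on the compact interval, so
    the infimum \<mu> is a genuine lower bound.\<close>
  have bdd: "bdd_below (f' ` {-\<beta>..\<beta>})"
    using continuous_attains_inf[OF compact_Icc _ f'_cont] beta by (force intro: bdd_belowI2)
  have mu_le: "\<mu> \<le> f' x" if "x \<in> {-\<beta>..\<beta>}" for x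
    unfolding mu by (rule cINF_lower[OF bdd that])
  obtain x where "x \<in> {-\<beta>..\<beta>}" "f' x < 0"
    using neg_deriv_if_nonconst[OF f_sign f_deriv f_nonconst] by blast
  then have mu_neg: "\<mu> < 0" using mu_le by fastforce
  then have "\<omega>\<^sub>0 > 0" by (simp add: omega0 divide_pos_neg)
  moreover have "\<forall>m\<le>M. max_norm (U m) \<le> \<beta>" if \<tau>: "0 < \<Delta>t" "\<Delta>t \<le> \<omega>\<^sub>0"
  proof -
    let ?N = "grid_size d n"
    have npos: "0 < n k" if "k < d" for k using n[OF that] by simp
    then have N: "0 < ?N" by (auto simp: grid_size_def intro!: prod_pos)
    have "- 1 \<le> \<Delta>t * f' x" if "x \<in> {-\<beta>..\<beta>}" for x
    proof -
      \<comment> \<open>Multiplying \<open>\<Delta>t \<le> - 1 / \<mu>\<close> by the negative \<mu>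
        reverses the inequality.\<close>
      have "- 1 \<le> \<Delta>t * \<mu>" using \<tau>(2) mu_neg by (simp add: omega0 field_simps)
      also have "\<dots> \<le> \<Delta>t * f' x" using mu_le[OF that] \<tau> by simp
      finally show ?thesis .
    qed
    then have g: "\<bar>x + \<Delta>t * f x\<bar> \<le> \<beta>" if "\<bar>x\<bar> \<le> \<beta>" for x
      using that \<tau> by (intro euler_map_bounded[OF f_sign f_deriv]) auto
    have rate: "rate_matrix ?N A"
      unfolding A by (intro rate_matrix_smult rate_matrix_neumann_laplacian d n) auto
    \<comment> \<open>The invariant starts from the bound on the initial datum, since all grid
      points lie in the closed box, and is preserved by whichever scheme is in force.\<close>
    have "vec_bounded ?N \<beta> (U m)" if "m \<le> M" for m
      using that
    proof (induction m)
      case 0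
      have "\<bar>u\<^sub>0 (grid_point d n a h j)\<bar> \<le> \<beta>" for j
      proof -
        have "grid_point d n a h j \<in> closed_box d a b"
          using h npos ab by (intro grid_point_in_closed_box) auto
        then have "ereal \<bar>u\<^sub>0 (grid_point d n a h j)\<bar> \<le> linf_norm_on (closed_box d a b) u\<^sub>0"
          unfolding linf_norm_on_def by (rule SUP_upper)
        then show ?thesis using u0 order.trans ereal_less_eq(3) by blast
      qed
      then show ?case by (simp add: U0 vec_bounded_def)
    next
      case (Suc m)
      then show ?case
        using scheme lri_step_vec_bounded[where f = f, OF rate _ g, of "U m"] \<tau>
        by (auto simp: Suc_le_eq)
    qed
    then show ?thesis using max_norm_le N by blast
  qed
  ultimately show ?thesis using mu_neg by blast
qed

end
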